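(* Let $A,B\subset \mathbb{R}$ be Lebesgue measurable sets such that every null subset of $A$ can be translated into $B$. Then there is a null set $N\subset A$ such that $A\setminus N$ can be translated into $B$.
   Context: A set $E\subset\mathbb{R}$ is null if its Lebesgue measure is $0$. A set $E\subset \mathbb{R}$ can be translated into a set $F\subset\mathbb{R}$ if there exists a real number $x$ such that $E+x=\{e+x : e\in E\}\subset F$. *)

theory Defs
  imports "HOL-Analysis.Analysis"
begin

definition translatable_into :: "real set \<Rightarrow> real set \<Rightarrow> bool" where
  "translatable_into E F \<longleftrightarrow> (\<exists>x::real. (\<lambda>e. e + x) ` E \<subseteq> F)"

end

theory Submission
  imports Defs
begin

text \<open>
  If no null set \<open>N\<close> works, then for every \<open>x\<close> the set \<open>{t \<in> A. t + x \<notin> B}\<close> contains a compact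
  set \<open>K\<close> of positive measure. The key point is a strengthening of Steinhaus' theorem: some compact
  null set \<open>E \<subseteq> K\<close> meets \<open>K + y\<close> for all small \<open>y\<close>, so that no translation by a number near \<open>x\<close>
  maps \<open>E\<close> into \<open>B\<close>. By Lindelof's theorem countably many such null sets obstruct all translations,
  and their union is a null subset of \<open>A\<close> that cannot be translated into \<open>B\<close>.

  To construct \<open>E\<close>, intersect \<open>K\<close> repeatedly with rapidly alternating periodic sets of density
  \<open>1/2\<close>. Each step reduces the measure by a fixed factor, whereas by continuity of translation
  the measures of the intersections with \<open>K + y\<close> stay bounded away from \<open>0\<close> uniformly in \<open>y\<close>.
\<close>

section \<open>Continuity of translation in measure\<close>

text \<open>An open \<open>U\<close> around \<open>K\<close> with \<open>U - K\<close> small in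
  measure contains a uniform neighbourhood of \<open>K\<close> by compactness, hence every small
  translate of \<open>K\<close>; what leaves \<open>K\<close> stays in \<open>U - K\<close>.\<close>

lemma compact_translation_diff_small:
  fixes K :: "'a::euclidean_space set"
  assumes "compact K" "0 < e"
  obtains r where "0 < r" "\<And>s. norm s < r \<Longrightarrow> measure lebesgue ((+) s ` K - K) < e"
proof -
  have K: "K \<in> lmeasurable"
    using assms lmeasurable_compact by blast
  then obtain U where U: "open U" "K \<subseteq> U" "U - K \<in> lmeasurable" "emeasure lebesgue (U - K) < ennreal e"
    using sets_lebesgue_outer_open[of K e] assms by blast
  obtain r where r: "0 < r" "(\<Union>x\<in>K. ball x r) \<subseteq> U"
    using compact_subset_open_imp_ball_epsilon_subset[OF \<open>compact K\<close> \<open>open U\<close> \<open>K \<subseteq> U\<close>] by blast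
  show thesis
  proof (rule that[OF \<open>0 < r\<close>])
    fix s :: 'a assume "norm s < r"
    then have "(+) s ` K - K \<subseteq> U - K"
      using r by (force simp: dist_norm)
    then have "measure lebesgue ((+) s ` K - K) \<le> measure lebesgue (U - K)"
      using U K by (intro measure_mono_fmeasurable) (auto intro!: sets.Diff lebesgue_sets_translation)
    also have "\<dots> < e"
      using U \<open>0 < e\<close> by (simp add: emeasure_eq_measure2 ennreal_less_iff)
    finally show "measure lebesgue ((+) s ` K - K) < e" .
  qed
qed

text \<open>Translation by \<open>s\<close> preserves measure and sends \<open>F \<inter> D\<close>
  into \<open>D'\<close>; only points that leave \<open>F\<close> fail to land in
  \<open>F \<inter> D'\<close>.\<close>

lemma measure_Int_translation_le:
  fixes F D D' :: "'a::euclidean_space set"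
  assumes F: "F \<in> lmeasurable" and D: "D \<in> sets lebesgue" "D' \<in> sets lebesgue"
    and "(+) s ` D \<subseteq> D'"
  shows "measure lebesgue (F \<inter> D) \<le> measure lebesgue (F \<inter> D') + measure lebesgue ((+) s ` F - F)"
proof -
  have FD: "F \<inter> D \<in> lmeasurable" "F \<inter> D' \<in> lmeasurable" "(+) s ` F - F \<in> lmeasurable"
    using F D by (auto intro: fmeasurable_Int_fmeasurable fmeasurable.Diff measurable_translation)
  have "measure lebesgue (F \<inter> D) = measure lebesgue ((+) s ` (F \<inter> D))"
    by (simp add: measure_translation)
  also have "\<dots> \<le> measure lebesgue ((F \<inter> D') \<union> ((+) s ` F - F))"
    using assms(4) FD
    by (intro measure_mono_fmeasurable) (auto intro!: lebesgue_sets_translation fmeasurable.Un)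
  also have "\<dots> \<le> measure lebesgue (F \<inter> D') + measure lebesgue ((+) s ` F - F)"
    using FD by (intro measure_Un_le) auto
  finally show ?thesis .
qed

section \<open>Periodic sets of density one half\<close>

lemma countable_sin_zeros: "countable {t::real. sin (c * t) = 0}" if "c \<noteq> 0"
proof (rule countable_subset)
  show "{t. sin (c * t) = 0} \<subseteq> (\<lambda>i. of_int i * pi / c) ` (UNIV :: int set)"
    using that by (auto simp: sin_zero_iff_int2 field_simps)
qed auto

text \<open>Take for \<open>D\<close> the nonnegativity set of a sine with half-period
  \<open>s\<close>. Translation by \<open>s\<close> swaps it with the nonpositivity set
  \<open>D'\<close>, so their shares of \<open>F\<close> can differ only by what leaves
  \<open>F\<close>. The two shares add up to \<open>F\<close> because they overlap in a null
  set.\<close>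

lemma half_density_set:
  fixes s :: real
  assumes "s \<noteq> 0"
  obtains D where "closed D"
    "\<And>F. F \<in> lmeasurable \<Longrightarrow>
       \<bar>2 * measure lebesgue (F \<inter> D) - measure lebesgue F\<bar> \<le> measure lebesgue ((+) s ` F - F)"
proof -
  define D where "D = {t. 0 \<le> sin (pi / s * t)}"
  define D' where "D' = {t. sin (pi / s * t) \<le> 0}"
  have "closed D" "closed D'"
    using assms unfolding D_def D'_def by (auto intro!: closed_Collect_le continuous_intros)
  then have D: "D \<in> sets lebesgue" "D' \<in> sets lebesgue"
    by auto
  have shift: "sin (pi / s * (s + t)) = - sin (pi / s * t)" for t
    using assms by (simp add: distrib_left sin_add)
  have DD': "(+) s ` D \<subseteq> D'" "(+) s ` D' \<subseteq> D"
    unfolding D_def D'_def by (auto simp only: image_subset_iff mem_Collect_eq shift)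
  have "D \<inter> D' = {t. sin (pi / s * t) = 0}"
    by (auto simp: D_def D'_def)
  then have null: "negligible (D \<inter> D')"
    using countable_sin_zeros[of "pi / s"] assms
    by (simp add: negligible_iff_null_sets null_sets_completionI countable_imp_null_set_lborel)
  have "\<bar>2 * measure lebesgue (F \<inter> D) - measure lebesgue F\<bar> \<le> measure lebesgue ((+) s ` F - F)"
    if F: "F \<in> lmeasurable" for F
  proof -
    have FD: "F \<inter> D \<in> lmeasurable" "F \<inter> D' \<in> lmeasurable"
      using F D by (auto intro: fmeasurable_Int_fmeasurable)
    have "F = (F \<inter> D) \<union> (F \<inter> D')"
      by (auto simp: D_def D'_def)
    moreover have "negligible ((F \<inter> D) \<inter> (F \<inter> D'))"
      using null by (rule negligible_subset) auto
    ultimately have "measure lebesgue F = measure lebesgue (F \<inter> D) + measure lebesgue (F \<inter> D')"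
      using FD measure_Un3[OF FD] by (simp add: negligible_imp_measure0)
    then show ?thesis
      using measure_Int_translation_le[OF F D DD'(1)] measure_Int_translation_le[OF F D(2,1) DD'(2)]
      by linarith
  qed
  with \<open>closed D\<close> show thesis
    by (rule that)
qed

text \<open>One step of the construction: intersect \<open>L\<close> with a half-density set whose
  half-period \<open>s\<close> is so small that \<open>L\<close> and \<open>K\<close> barely change
  under translation by \<open>s\<close>. One such \<open>s\<close> serves all \<open>y\<close> in
  \<open>Y\<close>.\<close>

lemma thin_compact_subset:
  fixes K L :: "real set"
  assumes K: "compact K" and L: "compact L" and "0 < d"
    and lower: "\<And>y. y \<in> Y \<Longrightarrow> d \<le> measure lebesgue (L \<inter> (+) y ` K)"
    and pos: "0 < measure lebesgue L"
  obtains L' where "compact L'" "L' \<subseteq> L" "measure lebesgue L' \<le> 2/3 * measure lebesgue L"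
    "\<And>y. y \<in> Y \<Longrightarrow> d / 4 \<le> measure lebesgue (L' \<inter> (+) y ` K)"
proof -
  obtain r where r: "0 < r" "\<And>s. \<bar>s\<bar> < r \<Longrightarrow> measure lebesgue ((+) s ` K - K) < d / 4"
    using compact_translation_diff_small[OF K, of "d / 4"] \<open>0 < d\<close> by auto
  \<comment> \<open>An error below a third of the measure of \<open>L\<close> gives the factor
    \<open>(1 + 1/3) / 2 = 2/3\<close>. Errors below \<open>d / 4\<close> from \<open>L\<close> and
    from \<open>K\<close> leave at least \<open>(d - d/2) / 2 = d / 4\<close>.\<close>
  have "0 < min (d / 4) (measure lebesgue L / 3)"
    using pos \<open>0 < d\<close> by simp
  then obtain q where q: "0 < q" "\<And>s. \<bar>s\<bar> < q \<Longrightarrow>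
      measure lebesgue ((+) s ` L - L) < min (d / 4) (measure lebesgue L / 3)"
    using compact_translation_diff_small[OF L] by (metis real_norm_def)
  define s where "s = min r q / 2"
  have s: "s \<noteq> 0" "\<bar>s\<bar> < r" "\<bar>s\<bar> < q"
    using r(1) q(1) by (auto simp: s_def)
  obtain D where D: "closed D" "\<And>F. F \<in> lmeasurable \<Longrightarrow>
      \<bar>2 * measure lebesgue (F \<inter> D) - measure lebesgue F\<bar> \<le> measure lebesgue ((+) s ` F - F)"
    using half_density_set[OF s(1)] by blast
  have Lm: "L \<in> lmeasurable" and Km: "K \<in> lmeasurable"
    using K L lmeasurable_compact by auto
  show thesis
  proof (rule that[of "L \<inter> D"])
    show "compact (L \<inter> D)"
      using L D(1) by blast
    show "measure lebesgue (L \<inter> D) \<le> 2/3 * measure lebesgue L"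
      using D(2)[OF Lm] q(2)[OF s(3)] by linarith
  next
    fix y assume "y \<in> Y"
    define F where "F = L \<inter> (+) y ` K"
    have sLm: "(+) s ` L - L \<in> lmeasurable" and sKm: "(+) y ` ((+) s ` K - K) \<in> lmeasurable"
      using Lm Km by (auto intro!: fmeasurable.Diff measurable_translation)
    have Fm: "F \<in> lmeasurable"
      using Lm Km by (auto simp: F_def intro!: fmeasurable.Int measurable_translation)
    \<comment> \<open>A point that leaves \<open>F\<close> leaves \<open>L\<close> or leaves
      \<open>K + y\<close>. The second set is a translate of a set independent of \<open>y\<close>,
      which makes the bound uniform in \<open>y\<close>.\<close>
    have "(+) s ` F - F \<subseteq> ((+) s ` L - L) \<union> (+) y ` ((+) s ` K - K)"
    proof
      fix t assume t: "t \<in> (+) s ` F - F"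
      then obtain k where k: "k \<in> K" "t = s + (y + k)" "y + k \<in> L"
        by (auto simp: F_def)
      have "t = y + (s + k)"
        using k by simp
      moreover from this have "t \<in> L \<Longrightarrow> s + k \<notin> K"
        using t by (auto simp: F_def)
      ultimately show "t \<in> ((+) s ` L - L) \<union> (+) y ` ((+) s ` K - K)"
        using k by blast
    qed
    then have "measure lebesgue ((+) s ` F - F)
        \<le> measure lebesgue (((+) s ` L - L) \<union> (+) y ` ((+) s ` K - K))"
      using sLm sKm Fm
      by (intro measure_mono_fmeasurable) (auto intro!: lebesgue_sets_translation sets.Diff fmeasurable.Un)
    also have "\<dots> \<le> measure lebesgue ((+) s ` L - L) + measure lebesgue ((+) y ` ((+) s ` K - K))"
      using sLm sKm by (intro measure_Un_le) auto
    also have "\<dots> < d / 2"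
      using q(2)[OF s(3)] r(2)[OF s(2)] by (simp add: measure_translation)
    finally have "d / 4 \<le> measure lebesgue (F \<inter> D)"
      using D(2)[OF Fm] lower[OF \<open>y \<in> Y\<close>, folded F_def] by linarith
    then show "d / 4 \<le> measure lebesgue (L \<inter> D \<inter> (+) y ` K)"
      by (simp add: F_def Int_ac)
  qed auto
qed

section \<open>A null set version of Steinhaus' theorem\<close>

lemma null_Steinhaus:
  fixes K :: "real set"
  assumes K: "compact K" and pos: "0 < measure lebesgue K"
  obtains r E where "0 < r" "E \<in> null_sets lebesgue" "E \<subseteq> K"
    "\<And>y. \<bar>y\<bar> < r \<Longrightarrow> E \<inter> (+) y ` K \<noteq> {}"
proof -
  define m where "m = measure lebesgue K"
  have m: "0 < m / 2"
    using pos by (simp add: m_def)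
  obtain r where r: "0 < r" "\<And>s. \<bar>s\<bar> < r \<Longrightarrow> measure lebesgue ((+) s ` K - K) < m / 2"
    using compact_translation_diff_small[OF K m] by (metis real_norm_def)
  have Km: "K \<in> lmeasurable"
    using K lmeasurable_compact by blast
  \<comment> \<open>The bound \<open>d\<close> is uniform in \<open>y\<close> but may depend on
    \<open>L\<close>: it shrinks at each step, and only its positivity matters.\<close>
  define P where "P L \<longleftrightarrow> compact L \<and>
      (\<exists>d>0. \<forall>y\<in>{-r<..<r}. d \<le> measure lebesgue (L \<inter> (+) y ` K))" for L
  have "P K"
  proof -
    have "m / 2 \<le> measure lebesgue (K \<inter> (+) y ` K)" if "y \<in> {-r<..<r}" for y
    proof -
      have yK: "(+) y ` K \<in> lmeasurable"
        using Km by (rule measurable_translation)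
      have "m = measure lebesgue ((+) y ` K)"
        by (simp add: m_def measure_translation)
      also have "\<dots> = measure lebesgue ((K \<inter> (+) y ` K) \<union> ((+) y ` K - K))"
        by (rule arg_cong[where f = "measure lebesgue"]) auto
      also have "\<dots> \<le> measure lebesgue (K \<inter> (+) y ` K) + measure lebesgue ((+) y ` K - K)"
        using Km yK by (intro measure_Un_le) auto
      finally show ?thesis
        using r(2)[of y] that by (simp add: abs_less_iff)
    qed
    then show ?thesis
      using K m unfolding P_def by blast
  qed
  have step: "\<exists>L'. P L' \<and> L' \<subseteq> L \<and> measure lebesgue L' \<le> 2/3 * measure lebesgue L" if "P L" for L
  proof -
    obtain d where L: "compact L" and d: "0 < d"
      "\<And>y. y \<in> {-r<..<r} \<Longrightarrow> d \<le> measure lebesgue (L \<inter> (+) y ` K)"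
      using \<open>P L\<close> unfolding P_def by blast
    \<comment> \<open>The case \<open>y = 0\<close> shows that \<open>L\<close> has positive
      measure, as thinning requires.\<close>
    have "d \<le> measure lebesgue (L \<inter> (+) 0 ` K)"
      using r(1) by (intro d(2)) simp
    also have "\<dots> \<le> measure lebesgue L"
      using lmeasurable_compact[OF L] Km by (intro measure_mono_fmeasurable) auto
    finally have "0 < measure lebesgue L"
      using d(1) by simp
    then obtain L' where "compact L'" "L' \<subseteq> L" "measure lebesgue L' \<le> 2/3 * measure lebesgue L"
      "\<And>y. y \<in> {-r<..<r} \<Longrightarrow> d / 4 \<le> measure lebesgue (L' \<inter> (+) y ` K)"
      using thin_compact_subset[OF K L d] by blast
    then show ?thesis
      using d(1) unfolding P_def by (intro exI[of _ L'] conjI exI[of _ "d / 4"]) auto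
  qed
  obtain f where f0: "f 0 = K" and Pf: "\<And>n. P (f n)"
    and f: "\<And>n. f (Suc n) \<subseteq> f n \<and> measure lebesgue (f (Suc n)) \<le> 2/3 * measure lebesgue (f n)"
    using dependent_nat_choice[of "\<lambda>n L. P L \<and> (n = 0 \<longrightarrow> L = K)"
        "\<lambda>n L L'. L' \<subseteq> L \<and> measure lebesgue L' \<le> 2/3 * measure lebesgue L"] \<open>P K\<close> step
    by (metis nat.distinct(1))
  have decr: "f n \<subseteq> f k" if "k \<le> n" for k n
    using that f by (rule_tac lift_Suc_antimono_le[of f]) auto
  have compact: "compact (f n)" for n
    using Pf by (simp add: P_def)
  define E where "E = \<Inter>(range f)"
  have bound: "measure lebesgue (f n) \<le> (2/3) ^ n * m" for n
  proof (induction n)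
    case (Suc n)
    then show ?case
      using f[of n] by simp
  qed (simp add: f0 m_def)
  have "negligible E"
    unfolding negligible_outer_le
  proof (intro allI impI)
    fix e :: real assume "0 < e"
    have "(\<lambda>n. (2/3) ^ n * m) \<longlonglongrightarrow> 0"
      by (intro tendsto_mult_left_zero LIMSEQ_power_zero) simp
    then have "\<forall>\<^sub>F n in sequentially. (2/3) ^ n * m < e"
      using \<open>0 < e\<close> by (rule order_tendstoD)
    then obtain n where "(2/3) ^ n * m < e"
      by (auto simp: eventually_sequentially)
    with bound[of n] show "\<exists>T. E \<subseteq> T \<and> T \<in> lmeasurable \<and> measure lebesgue T \<le> e"
      using compact by (intro exI[of _ "f n"]) (auto simp: E_def intro: lmeasurable_compact)
  qed
  moreover have "E \<inter> (+) y ` K \<noteq> {}" if "\<bar>y\<bar> < r" for y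
  proof -
    \<comment> \<open>Although the measures tend to \<open>0\<close>, each stage is nonempty, so
      Cantor's intersection theorem yields a common point.\<close>
    have "\<Inter>(range (\<lambda>n. f n \<inter> (+) y ` K)) \<noteq> {}"
    proof (rule compact_nest)
      show "compact (f n \<inter> (+) y ` K)" for n
        using compact K by (intro compact_Int compact_translation)
      have "y \<in> {-r<..<r}"
        using that by (simp add: abs_less_iff)
      then have "0 < measure lebesgue (f n \<inter> (+) y ` K)" for n
        using Pf[of n] unfolding P_def by (meson less_le_trans)
      then show "f n \<inter> (+) y ` K \<noteq> {}" for n
        by (metis less_irrefl measure_empty)
    qed (use decr in blast)
    then show ?thesis
      by (auto simp: E_def)
  qed
  moreover have "E \<subseteq> K"
    using f0 by (auto simp: E_def)
  ultimately show thesis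
    using that r(1) by (simp add: negligible_iff_null_sets)
qed

section \<open>Obstructing all translations\<close>

text \<open>Cutting \<open>S\<close> down to a ball gives finite positive measure and makes the
  closed set from inner regularity compact.\<close>

lemma compact_subset_pos_measure:
  fixes S :: "'a::euclidean_space set"
  assumes S: "S \<in> sets lebesgue" and "\<not> negligible S"
  obtains K where "compact K" "K \<subseteq> S" "0 < measure lebesgue K"
proof -
  obtain n :: nat where n: "\<not> negligible (S \<inter> cball 0 n)"
  proof -
    have "S = (\<Union>n::nat. S \<inter> cball 0 n)"
      using real_arch_simple by auto
    with \<open>\<not> negligible S\<close> that show thesis
      using negligible_countable_Union[of "range (\<lambda>n::nat. S \<inter> cball 0 n)"] by fastforce
  qed
  define T where "T = S \<inter> cball 0 (real n)"
  have T: "T \<in> lmeasurable"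
    using S unfolding T_def by (intro bounded_set_imp_lmeasurable) auto
  have "0 < measure lebesgue T"
    using n T by (metis T_def negligible_iff_measure zero_less_measure_iff measure_nonneg order_le_less)
  then obtain K where K: "closed K" "K \<subseteq> T" "T - K \<in> lmeasurable"
      "emeasure lebesgue (T - K) < ennreal (measure lebesgue T)"
    using sets_lebesgue_inner_closed[of T "measure lebesgue T"] T by blast
  have "compact K"
    using K by (metis T_def bounded_cball bounded_subset compact_eq_bounded_closed le_inf_iff)
  moreover have "measure lebesgue (T - K) < measure lebesgue T"
    using K \<open>0 < measure lebesgue T\<close> by (simp add: emeasure_eq_measure2 ennreal_less_iff)
  then have "0 < measure lebesgue K"
    using measurable_measure_Diff[OF T, of K] K lmeasurable_compact[OF \<open>compact K\<close>] by auto
  ultimately show thesis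
    using that K by (auto simp: T_def)
qed

theorem theorem1p1:
  fixes A B :: "real set"
  assumes "A \<in> sets lebesgue" and "B \<in> sets lebesgue"
    and "\<And>E. E \<in> null_sets lebesgue \<Longrightarrow> E \<subseteq> A \<Longrightarrow> translatable_into E B"
  shows "\<exists>N. N \<in> null_sets lebesgue \<and> N \<subseteq> A \<and> translatable_into (A - N) B"
proof (rule ccontr)
  assume contra: "\<not> ?thesis"
  have "\<exists>r E. 0 < r \<and> E \<in> null_sets lebesgue \<and> E \<subseteq> A \<and>
      (\<forall>z\<in>ball x r. \<not> (\<lambda>e. e + z) ` E \<subseteq> B)" for x
  proof -
    \<comment> \<open>The points of \<open>A\<close> that translation by \<open>x\<close> moves
      outside \<open>B\<close>. As \<open>A - M\<close> is translated into \<open>B\<close>, a null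
      \<open>M\<close> would contradict \<open>contra\<close>.\<close>
    define M where "M = A - (+) (- x) ` B"
    have M: "t + x \<notin> B" if "t \<in> M" for t
      using that by (force simp: M_def)
    have "M \<in> sets lebesgue"
      using assms unfolding M_def by (intro sets.Diff lebesgue_sets_translation)
    moreover have "translatable_into (A - M) B"
      unfolding translatable_into_def M_def by (rule exI[of _ x]) auto
    then have "\<not> negligible M"
      using contra by (auto simp: M_def negligible_iff_null_sets)
    ultimately obtain K where K: "compact K" "K \<subseteq> M" "0 < measure lebesgue K"
      by (rule compact_subset_pos_measure)
    obtain r E where rE: "0 < r" "E \<in> null_sets lebesgue" "E \<subseteq> K"
      "\<And>y. \<bar>y\<bar> < r \<Longrightarrow> E \<inter> (+) y ` K \<noteq> {}"
      using null_Steinhaus[OF K(1,3)] by blast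
    have "\<not> (\<lambda>e. e + z) ` E \<subseteq> B" if "z \<in> ball x r" for z
    proof -
      \<comment> \<open>With \<open>y = x - z\<close>, some \<open>k\<close> in \<open>K\<close> has
        \<open>k + y\<close> in \<open>E\<close>; translation by \<open>z\<close> moves this point
        to \<open>k + x\<close>, outside \<open>B\<close>.\<close>
      have "\<bar>x - z\<bar> < r"
        using that by (simp add: dist_real_def)
      then obtain k where k: "k \<in> K" "x - z + k \<in> E"
        using rE(4) by blast
      then have "(x - z + k) + z \<notin> B"
        using M[of k] K(2) by (auto simp: add.commute)
      then show ?thesis
        using k by blast
    qed
    then show ?thesis
      using rE(1-3) K(2) unfolding M_def by blast
  qed
  then obtain r E where r: "\<And>x. 0 < r x" and E: "\<And>x. E x \<in> null_sets lebesgue" "\<And>x. E x \<subseteq> A"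
    and notB: "\<And>x z. z \<in> ball x (r x) \<Longrightarrow> \<not> (\<lambda>e. e + z) ` E x \<subseteq> B"
    by metis
  \<comment> \<open>Countably many of the balls already cover the line, so the union of their sets
    \<open>E x\<close> stays null.\<close>
  obtain \<F> where \<F>: "\<F> \<subseteq> range (\<lambda>x. ball x (r x))" "countable \<F>"
      "\<Union>\<F> = (\<Union>x. ball x (r x))"
    by (rule Lindelof[of "range (\<lambda>x. ball x (r x))"]) auto
  obtain X where X: "countable X" "\<F> = (\<lambda>x. ball x (r x)) ` X"
    using \<F>(1,2) countable_image_eq_inj subset_image_inj by (metis countable_subset_image)
  have "(\<Union>x\<in>X. E x) \<in> null_sets lebesgue"
    using X(1) E(1) by (rule null_sets_UN')
  moreover have "(\<Union>x\<in>X. E x) \<subseteq> A"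
    using E(2) by blast
  ultimately obtain z where z: "(\<lambda>e. e + z) ` (\<Union>x\<in>X. E x) \<subseteq> B"
    using assms(3) unfolding translatable_into_def by blast
  have "z \<in> \<Union>\<F>"
    unfolding \<F>(3) using r[of z] by (intro UN_I[of z]) auto
  then obtain x where "x \<in> X" "z \<in> ball x (r x)"
    using X(2) by blast
  with notB z show False
    by blast
qed

end
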